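(* Let $c\in \mathcal{C}([-1,1];\mathbb{R})$ and let $m\in\mathcal{C}^1([-1,1];\mathbb{R})$ satisfy condition (Hm) (stated in the context). For each $s$, let $\varphi_s$ be the principal eigenfunction of $$-\varphi''-2s\,m'(x)\varphi'+c(x)\varphi=\lambda\varphi \ \text{ in } [-1,1],\qquad \varphi'(-1)=\varphi'(1)=0,$$ normalized by $\max_{|x|\le 1}\varphi_s(x)=1$. Then $$\lim_{s\to\infty}\|\varphi_s'\|_\infty=0\quad\text{and}\quad \lim_{s\to\infty}\|\varphi_s-1\|_\infty=0 .$$
   Context: Here $\|h\|_\infty$ denotes the supremum norm of $h$ on $[-1,1]$. Condition (Hm): $m\in\mathcal{C}^1([-1,1];\mathbb{R})$, and there is a unique $x_0\in(-1,1)$ such that $m(x_0)=\|m\|_\infty=\max_{|x|\le 1}m(x)$. Moreover, $m'(x)\ge 0$ for all $x\in[-1,x_0)$, $m'(x)\le 0$ for all $x\in(x_0,1]$, and $m$ has at most finitely many critical points (zeros of $m'$) in $(-1,1)$. For each $s\in\mathbb{R}$, the principal eigenvalue $\lambda(s)$ of the Neumann problem $-\varphi''-2s\,m'(x)\varphi'+c(x)\varphi=\lambda\varphi$ in $[-1,1]$, $\varphi'(-1)=\varphi'(1)=0$, is the unique real number $\lambda$ for which this problem has a positive solution; the principal eigenfunction $\varphi_s\in\mathcal{C}^2([-1,1])$ is the associated positive eigenfunction, unique up to a positive multiplicative constant, and hence unique once normalized by $\max_{|x|\le 1}\varphi_s(x)=1$. *)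

theory Defs
  imports "HOL-Analysis.Analysis"
begin

abbreviation I :: "real set" where
  "I \<equiv> {-1..1}"

text \<open>Functions on the interval are represented by total functions of which only the values
  on the interval matter. Accordingly derivatives are taken within the interval, hence one-sided
  at the endpoints. The library's \<^const>\<open>C1_differentiable_on\<close> is not used, since it
  would ask for two-sided derivatives at the endpoints.\<close>

definition derivI :: "(real \<Rightarrow> real) \<Rightarrow> real \<Rightarrow> real" where
  "derivI f x = vector_derivative f (at x within I)"

definition C1 :: "(real \<Rightarrow> real) \<Rightarrow> bool" where
  "C1 f \<longleftrightarrow> f differentiable_on I \<and> continuous_on I (derivI f)"

definition C2 :: "(real \<Rightarrow> real) \<Rightarrow> bool" where
  "C2 f \<longleftrightarrow> C1 f \<and> C1 (derivI f)"

text \<open>The two suprema below are only applied to functions that are continuous on the compact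
  interval, so that they are finite and attained.\<close>

definition sup_norm :: "(real \<Rightarrow> real) \<Rightarrow> real" where
  "sup_norm f = (SUP x\<in>I. \<bar>f x\<bar>)"

definition maxI :: "(real \<Rightarrow> real) \<Rightarrow> real" where
  "maxI f = (SUP x\<in>I. f x)"

definition max_point :: "(real \<Rightarrow> real) \<Rightarrow> real \<Rightarrow> bool" where
  "max_point m x \<longleftrightarrow> x \<in> {-1<..<1} \<and> m x = sup_norm m \<and> sup_norm m = maxI m"

definition Hm :: "(real \<Rightarrow> real) \<Rightarrow> bool" where
  "Hm m \<longleftrightarrow> C1 m \<and>
    (\<exists>x0. max_point m x0 \<and> (\<forall>y. max_point m y \<longrightarrow> y = x0) \<and>
       (\<forall>x\<in>{-1..<x0}. derivI m x \<ge> 0) \<and> (\<forall>x\<in>{x0<..1}. derivI m x \<le> 0)) \<and>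
    finite {x \<in> {-1<..<1}. derivI m x = 0}"

definition positive_solution ::
    "(real \<Rightarrow> real) \<Rightarrow> (real \<Rightarrow> real) \<Rightarrow> real \<Rightarrow> real \<Rightarrow> (real \<Rightarrow> real) \<Rightarrow> bool" where
  "positive_solution m c s l \<phi> \<longleftrightarrow> C2 \<phi> \<and>
    (\<forall>x\<in>I. - derivI (derivI \<phi>) x - 2 * s * derivI m x * derivI \<phi> x + c x * \<phi> x = l * \<phi> x) \<and>
    derivI \<phi> (-1) = 0 \<and> derivI \<phi> 1 = 0 \<and>
    (\<forall>x\<in>I. \<phi> x > 0)"

definition principal_eigenvalue :: "(real \<Rightarrow> real) \<Rightarrow> (real \<Rightarrow> real) \<Rightarrow> real \<Rightarrow> real" where
  "principal_eigenvalue m c s = (THE l. \<exists>\<phi>. positive_solution m c s l \<phi>)"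

definition normalized_principal_eigenfunction ::
    "(real \<Rightarrow> real) \<Rightarrow> (real \<Rightarrow> real) \<Rightarrow> real \<Rightarrow> (real \<Rightarrow> real) \<Rightarrow> bool" where
  "normalized_principal_eigenfunction m c s \<phi> \<longleftrightarrow>
    positive_solution m c s (principal_eigenvalue m c s) \<phi> \<and> maxI \<phi> = 1"

lemma C1_has_derivI:
  assumes "C1 f" "x \<in> I"
  shows "(f has_real_derivative derivI f x) (at x within I)"
proof -
  have "f differentiable (at x within I)"
    using assms by (auto simp: C1_def differentiable_on_def)
  then show ?thesis
    unfolding derivI_def has_real_derivative_iff_has_vector_derivative
    by (simp add: vector_derivative_works)
qed

text \<open>The definite description in \<^const>\<open>principal_eigenvalue\<close> is well posed: apply Rolle's
  theorem to the weighted Wronskian of two positive solutions.\<close>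

lemma principal_eigenvalue_eq:
  assumes m: "C1 m" and sol: "positive_solution m c s l \<phi>"
  shows "principal_eigenvalue m c s = l"
proof -
  have "k = l" if psi: "positive_solution m c s k \<psi>" for k \<psi>
  proof -
    define W where
      "W x = exp (2 * s * m x) * (derivI \<phi> x * \<psi> x - \<phi> x * derivI \<psi> x)" for x
    have W: "(W has_real_derivative exp (2 * s * m x) * ((k - l) * (\<phi> x * \<psi> x))) (at x within I)"
      if x: "x \<in> I" for x
    proof -
      note d = C1_has_derivI[OF _ x]
      have C: "C1 \<phi>" "C1 (derivI \<phi>)" "C1 \<psi>" "C1 (derivI \<psi>)"
        using sol psi by (auto simp: positive_solution_def C2_def)
      have e1: "derivI (derivI \<phi>) x = c x * \<phi> x - l * \<phi> x - 2 * s * derivI m x * derivI \<phi> x"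
        using sol x by (force simp: positive_solution_def)
      have e2: "derivI (derivI \<psi>) x = c x * \<psi> x - k * \<psi> x - 2 * s * derivI m x * derivI \<psi> x"
        using psi x by (force simp: positive_solution_def)
      have "(W has_real_derivative
          exp (2 * s * m x) * (2 * s * derivI m x) * (derivI \<phi> x * \<psi> x - \<phi> x * derivI \<psi> x) +
          (derivI (derivI \<phi>) x * \<psi> x + derivI \<psi> x * derivI \<phi> x -
            (derivI \<phi> x * derivI \<psi> x + derivI (derivI \<psi>) x * \<phi> x)) * exp (2 * s * m x))
          (at x within I)"
        unfolding W_def
        by (rule DERIV_mult Deriv.field_differentiable_diff
            DERIV_chain2[OF DERIV_exp DERIV_cmult[OF d[OF m]]] d[OF C(1)] d[OF C(2)] d[OF C(3)]
            d[OF C(4)])+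
      then show ?thesis
        unfolding e1 e2 by (rule DERIV_cong) (simp add: algebra_simps)
    qed
    have "\<exists>z. - 1 < z \<and> z < 1 \<and> (\<lambda>h. h * (exp (2 * s * m z) * ((k - l) * (\<phi> z * \<psi> z)))) = (\<lambda>h. 0)"
    proof (rule Rolle_deriv[where f = W])
      show "W (- 1) = W 1"
        using sol psi by (simp add: W_def positive_solution_def)
      show "continuous_on {- 1..1} W"
        by (rule DERIV_continuous_on[OF W])
      show "(W has_derivative (\<lambda>h. h * (exp (2 * s * m x) * ((k - l) * (\<phi> x * \<psi> x))))) (at x)"
        if "- 1 < x" "x < 1" for x
      proof -
        have "at x within I = at x"
          using that by (intro at_within_interior) auto
        then show ?thesis
          using W[of x] that by (simp add: has_field_derivative_def mult_commute_abs)
      qed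
    qed simp
    then obtain z where z: "- 1 < z" "z < 1"
      and eq: "(\<lambda>h. h * (exp (2 * s * m z) * ((k - l) * (\<phi> z * \<psi> z)))) = (\<lambda>h. 0)" by blast
    have "1 * (exp (2 * s * m z) * ((k - l) * (\<phi> z * \<psi> z))) = 0"
      using fun_cong[OF eq, of 1] by blast
    moreover have "\<phi> z > 0" "\<psi> z > 0"
      using sol psi z by (auto simp: positive_solution_def)
    ultimately show "k = l" by simp
  qed
  then show ?thesis
    unfolding principal_eigenvalue_def using sol by (intro the_equality) blast+
qed

end

theory Submission
  imports Defs
begin

text \<open>In divergence form the equation reads
  \<open>(exp (2 s m) \<phi>')' = exp (2 s m) (c - \<lambda>) \<phi>\<close>, so the flux \<open>g = exp (2 s m) \<phi>'\<close> vanishes at both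
  endpoints. By Rolle's theorem \<open>c - \<lambda>\<close> has a zero, which bounds \<open>c - \<lambda>\<close> by a constant \<open>K\<close>
  independent of \<open>s\<close>; since \<open>0 < \<phi> \<le> 1\<close>, this gives \<open>\<bar>g'\<bar> \<le> K exp (2 s m)\<close>.

  To the left of the maximum point \<open>x0\<close> the function \<open>m\<close> is strictly increasing, because it has
  only finitely many critical points. Hence, for large \<open>s\<close>, the weight \<open>exp (2 s m)\<close> on the interval
  from \<open>-1\<close> to \<open>x\<close> is concentrated near the right end \<open>x\<close>, so that
  \<open>\<bar>\<phi>' x\<bar> \<le> K \<integral> exp (- 2 s (m x - m t)) dt\<close> tends to zero, uniformly in \<open>x\<close> because \<open>m x - m t\<close> is
  bounded below by a positive constant whenever \<open>x - t \<ge> \<delta>\<close> (\<open>uniform_gap\<close>, \<open>flux_small\<close>). To the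
  right of \<open>x0\<close> the same argument runs from the other endpoint, after reflection. Finally \<open>\<phi>\<close> attains the value \<open>1\<close>, and the
  mean value theorem turns smallness of \<open>\<phi>'\<close> into smallness of \<open>\<phi> - 1\<close>.\<close>

section \<open>Strict monotonicity from finitely many critical points\<close>

text \<open>If \<open>f\<close> took the same value twice, monotonicity would make it constant in between, and every
  point there would be critical.\<close>

lemma strict_mono_on_finite_critical:
  fixes f f' :: "real \<Rightarrow> real"
  assumes deriv: "\<And>x. x \<in> {a..b} \<Longrightarrow> (f has_real_derivative f' x) (at x within {a..b})"
    and nonneg: "\<And>x. a < x \<Longrightarrow> x < b \<Longrightarrow> f' x \<ge> 0"
    and fin: "finite {x \<in> {a<..<b}. f' x = 0}"
  shows "strict_mono_on {a..b} f"
proof (rule strict_mono_onI)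
  fix x y assume xy: "x \<in> {a..b}" "y \<in> {a..b}" "x < y"
  have deriv_at: "(f has_real_derivative f' t) (at t)" if "a < t" "t < b" for t
    using deriv[of t] at_within_Icc_at[OF that] that by simp
  have mono: "f u \<le> f v" if "x \<le> u" "u \<le> v" "v \<le> y" for u v
  proof (rule DERIV_nonneg_imp_increasing_open[OF that(2)])
    show "\<exists>d. (f has_real_derivative d) (at t) \<and> 0 \<le> d" if "u < t" "t < v" for t
      using deriv_at[of t] nonneg[of t] that xy \<open>x \<le> u\<close> \<open>v \<le> y\<close> by auto
    show "continuous_on {u..v} f"
      using that xy by (intro continuous_on_subset[OF DERIV_continuous_on[OF deriv]]) auto
  qed
  show "f x < f y"
  proof (rule ccontr)
    assume "\<not> f x < f y"
    then have const: "f t = f x" if "t \<in> {x<..<y}" for t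
      using mono[of x t] mono[of t y] that by force
    have "f' t = 0" if t: "t \<in> {x<..<y}" for t
    proof -
      have "(f has_real_derivative 0) (at t)"
        by (rule has_field_derivative_transform_within_open[of "\<lambda>_. f x" 0 t "{x<..<y}"])
          (use t const in simp_all)
      then show ?thesis
        using deriv_at[of t] t xy by (auto intro: DERIV_unique)
    qed
    then have "{x<..<y} \<subseteq> {x \<in> {a<..<b}. f' x = 0}"
      using xy by auto
    then show False
      using fin finite_subset infinite_Ioo[OF \<open>x < y\<close>] by blast
  qed
qed

section \<open>Concentration of an exponential weight\<close>

text \<open>By compactness the increment over steps of length \<open>\<delta>\<close> attains its minimum, which is positive;
  this is what makes the later estimate uniform in \<open>x\<close>.\<close>

lemma uniform_gap:
  fixes f :: "real \<Rightarrow> real"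
  assumes cont: "continuous_on {a..b} f" and mono: "strict_mono_on {a..b} f" and "\<delta> > 0"
  shows "\<exists>\<eta>>0. \<forall>x. a + \<delta> \<le> x \<and> x \<le> b \<longrightarrow> f x - f (x - \<delta>) \<ge> \<eta>"
proof (cases "a + \<delta> \<le> b")
  case True
  then have nonempty: "{a + \<delta>..b} \<noteq> {}"
    by simp
  have "continuous_on {a + \<delta>..b} f"
    using \<open>\<delta> > 0\<close> by (intro continuous_on_subset[OF cont]) simp
  moreover have "continuous_on {a + \<delta>..b} (\<lambda>x. f (x - \<delta>))"
  proof (rule continuous_on_compose2[OF cont])
    show "continuous_on {a + \<delta>..b} (\<lambda>x. x - \<delta>)"
      by (intro continuous_intros)
    show "(\<lambda>x. x - \<delta>) ` {a + \<delta>..b} \<subseteq> {a..b}"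
      by (rule image_subsetI) (use \<open>\<delta> > 0\<close> in simp)
  qed
  ultimately have "continuous_on {a + \<delta>..b} (\<lambda>x. f x - f (x - \<delta>))"
    by (rule continuous_on_diff)
  then obtain z where z: "z \<in> {a + \<delta>..b}"
    and le: "\<forall>x\<in>{a + \<delta>..b}. f z - f (z - \<delta>) \<le> f x - f (x - \<delta>)"
    using continuous_attains_inf[OF compact_Icc nonempty] by blast
  have "f (z - \<delta>) < f z"
    using z \<open>\<delta> > 0\<close> by (intro strict_mono_onD[OF mono]) auto
  then show ?thesis
    using le by (intro exI[of _ "f z - f (z - \<delta>)"]) auto
next
  case False
  then show ?thesis by (intro exI[of _ 1]) auto
qed

text \<open>This is the bound \<open>exp (- 2 s w x) \<integral> exp (2 s w t) dt = o(1)\<close> for the integral from \<open>a\<close> to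
  \<open>x\<close>, uniformly in \<open>x\<close>, in a form that needs only the mean value theorem: the part with
  \<open>t \<le> x - \<delta>\<close> contributes at most \<open>(b - a) exp (- 2 s \<eta>)\<close>, the remaining part at most \<open>\<delta>\<close>.
  The threshold for \<open>s\<close> does not depend on \<open>g\<close>, which in the application varies with \<open>s\<close>.\<close>

lemma flux_small:
  fixes w :: "real \<Rightarrow> real"
  assumes cont: "continuous_on {a..b} w" and mono: "strict_mono_on {a..b} w"
    and "a \<le> b" "K > 0" "\<epsilon> > 0"
  obtains S where "\<And>s g g' x. s \<ge> S \<Longrightarrow> g a = 0 \<Longrightarrow>
    (\<And>t. t \<in> {a..b} \<Longrightarrow> (g has_real_derivative g' t) (at t within {a..b})) \<Longrightarrow>
    (\<And>t. t \<in> {a..b} \<Longrightarrow> \<bar>g' t\<bar> \<le> K * exp (2 * s * w t)) \<Longrightarrow>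
    x \<in> {a..b} \<Longrightarrow> \<bar>g x\<bar> \<le> \<epsilon> * exp (2 * s * w x)"
proof -
  \<comment> \<open>With this choice the points nearer to \<open>x\<close> than \<open>\<delta>\<close> contribute half of the allowed error.\<close>
  define \<delta> where "\<delta> = \<epsilon> / (2 * K)"
  have "\<delta> > 0" using assms by (simp add: \<delta>_def)
  have K\<delta>: "K * \<delta> = \<epsilon> / 2" using \<open>K > 0\<close> by (simp add: \<delta>_def)
  obtain \<eta> where "\<eta> > 0" and gap: "\<And>x. a + \<delta> \<le> x \<Longrightarrow> x \<le> b \<Longrightarrow> w x - w (x - \<delta>) \<ge> \<eta>"
    using uniform_gap[OF cont mono \<open>\<delta> > 0\<close>] by blast
  have "((\<lambda>s. K * (b - a) * exp (- (2 * \<eta> * s))) \<longlongrightarrow> K * (b - a) * 0) at_top"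
    by (intro tendsto_intros filterlim_compose[OF exp_at_bot]
        filterlim_compose[OF filterlim_uminus_at_bot_at_top]
        filterlim_tendsto_pos_mult_at_top[OF tendsto_const] filterlim_ident)
      (use \<open>\<eta> > 0\<close> in auto)
  then have "eventually (\<lambda>s. K * (b - a) * exp (- (2 * \<eta> * s)) < \<epsilon> / 2) at_top"
    using \<open>\<epsilon> > 0\<close> by (intro order_tendstoD(2)) auto
  then obtain S0 where S0: "\<And>s. s \<ge> S0 \<Longrightarrow> K * (b - a) * exp (- (2 * \<eta> * s)) < \<epsilon> / 2"
    by (auto simp: eventually_at_top_linorder)
  show ?thesis
    \<comment> \<open>Nonnegative \<open>s\<close> makes \<open>exp (2 s w)\<close> increase with \<open>w\<close>.\<close>
  proof (rule that[of "max S0 0"])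
    fix s x and g g' :: "real \<Rightarrow> real"
    assume s: "s \<ge> max S0 0" and ga: "g a = 0" and x: "x \<in> {a..b}"
      and g': "\<And>t. t \<in> {a..b} \<Longrightarrow> (g has_real_derivative g' t) (at t within {a..b})"
      and bound: "\<And>t. t \<in> {a..b} \<Longrightarrow> \<bar>g' t\<bar> \<le> K * exp (2 * s * w t)"
    have step: "\<bar>g v - g u\<bar> \<le> K * exp (2 * s * w v) * (v - u)" if "a \<le> u" "u \<le> v" "v \<le> b" for u v
    proof -
      have "norm (g v - g u) \<le> K * exp (2 * s * w v) * norm (v - u)"
      proof (rule field_differentiable_bound[of "{u..v}"])
        fix t assume t: "t \<in> {u..v}"
        then show "(g has_real_derivative g' t) (at t within {u..v})"
          using that by (intro DERIV_subset[OF g']) auto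
        have "w t \<le> w v"
          using t that by (intro strict_mono_on_leD[OF mono]) auto
        then have "K * exp (2 * s * w t) \<le> K * exp (2 * s * w v)"
          using s \<open>K > 0\<close> by (simp add: mult_left_mono)
        moreover have "\<bar>g' t\<bar> \<le> K * exp (2 * s * w t)"
          using t that by (intro bound) simp
        ultimately show "norm (g' t) \<le> K * exp (2 * s * w v)"
          by simp
      qed (use that in auto)
      then show ?thesis using that by simp
    qed
    show "\<bar>g x\<bar> \<le> \<epsilon> * exp (2 * s * w x)"
    proof (cases "a + \<delta> \<le> x")
      case True
      have "\<bar>g (x - \<delta>)\<bar> \<le> K * exp (2 * s * w (x - \<delta>)) * (x - \<delta> - a)"
        using step[of a "x - \<delta>"] True x \<open>\<delta> > 0\<close> ga by simp
      also have "\<dots> \<le> K * exp (2 * s * w x - 2 * \<eta> * s) * (b - a)"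
      proof (intro mult_mono)
        have "2 * s * \<eta> \<le> 2 * s * (w x - w (x - \<delta>))"
          using gap[of x] True x s by (intro mult_left_mono) auto
        then show "exp (2 * s * w (x - \<delta>)) \<le> exp (2 * s * w x - 2 * \<eta> * s)"
          by (simp add: algebra_simps)
      qed (use \<open>K > 0\<close> \<open>\<delta> > 0\<close> x True in auto)
      also have "\<dots> = (K * (b - a) * exp (- (2 * \<eta> * s))) * exp (2 * s * w x)"
        by (simp add: exp_diff exp_minus field_simps)
      also have "\<dots> \<le> \<epsilon> / 2 * exp (2 * s * w x)"
        using S0[of s] s by (intro mult_right_mono) auto
      finally have far: "\<bar>g (x - \<delta>)\<bar> \<le> \<epsilon> / 2 * exp (2 * s * w x)" .
      have "\<bar>g x - g (x - \<delta>)\<bar> \<le> K * \<delta> * exp (2 * s * w x)"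
        using step[of "x - \<delta>" x] True x \<open>\<delta> > 0\<close> by (simp add: mult.commute mult.left_commute)
      then show ?thesis
        using far unfolding K\<delta> by linarith
    next
      case False
      have "\<bar>g x\<bar> \<le> K * exp (2 * s * w x) * (x - a)"
        using step[of a x] x ga by simp
      also have "\<dots> \<le> K * exp (2 * s * w x) * \<delta>"
        using False \<open>K > 0\<close> by (intro mult_left_mono) auto
      also have "\<dots> = \<epsilon> / 2 * exp (2 * s * w x)"
        using K\<delta> by (simp add: mult.commute mult.left_commute)
      also have "\<dots> \<le> \<epsilon> * exp (2 * s * w x)"
        using \<open>\<epsilon> > 0\<close> by simp
      finally show ?thesis .
    qed
  qed
qed

section \<open>The flux of an eigenfunction\<close>

lemma eigenfunction_attains_one:
  assumes "normalized_principal_eigenfunction m c s \<phi>"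
  shows "\<forall>x\<in>I. \<phi> x \<le> 1" "\<exists>x\<in>I. \<phi> x = 1"
proof -
  have "C1 \<phi>"
    using assms by (simp add: normalized_principal_eigenfunction_def positive_solution_def C2_def)
  then have cont: "continuous_on I \<phi>"
    by (rule DERIV_continuous_on[OF C1_has_derivI])
  obtain z where z: "z \<in> I" "\<forall>x\<in>I. \<phi> x \<le> \<phi> z"
    using continuous_attains_sup[of I \<phi>] cont by auto
  have "maxI \<phi> = \<phi> z"
    unfolding maxI_def using z by (intro cSup_eq_maximum) auto
  then have "\<phi> z = 1"
    using assms by (simp add: normalized_principal_eigenfunction_def)
  then show "\<forall>x\<in>I. \<phi> x \<le> 1" "\<exists>x\<in>I. \<phi> x = 1"
    using z by auto
qed

text \<open>The flux vanishes at both endpoints, so its derivative \<open>exp (2 s m) (c - l) \<phi>\<close> vanishes in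
  between, where the eigenvalue \<open>l\<close> must equal \<open>c\<close>. Hence \<open>\<bar>c - l\<bar>\<close> is at most \<open>2 * B\<close> whatever
  \<open>s\<close> is, and \<open>0 < \<phi> \<le> 1\<close>.\<close>

lemma normalized_flux_bound:
  assumes m: "C1 m" and \<phi>: "normalized_principal_eigenfunction m c s \<phi>"
    and B: "\<And>x. x \<in> I \<Longrightarrow> \<bar>c x\<bar> \<le> B"
  obtains g g' where "\<And>x. g x = exp (2 * s * m x) * derivI \<phi> x" "g (-1) = 0" "g 1 = 0"
    "\<And>x. x \<in> I \<Longrightarrow> (g has_real_derivative g' x) (at x within I)"
    "\<And>x. x \<in> I \<Longrightarrow> \<bar>g' x\<bar> \<le> 2 * B * exp (2 * s * m x)"
proof -
  obtain l where sol: "positive_solution m c s l \<phi>"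
    using \<phi> by (auto simp: normalized_principal_eigenfunction_def)
  have C: "C1 (derivI \<phi>)" and ends: "derivI \<phi> (-1) = 0" "derivI \<phi> 1 = 0"
    and pos: "\<And>x. x \<in> I \<Longrightarrow> \<phi> x > 0"
    and ode: "\<And>x. x \<in> I \<Longrightarrow>
      - derivI (derivI \<phi>) x - 2 * s * derivI m x * derivI \<phi> x + c x * \<phi> x = l * \<phi> x"
    using sol by (simp_all add: positive_solution_def C2_def)
  define g where "g x = exp (2 * s * m x) * derivI \<phi> x" for x
  define g' where "g' x = exp (2 * s * m x) * ((c x - l) * \<phi> x)" for x
  have deriv: "(g has_real_derivative g' x) (at x within I)" if "x \<in> I" for x
  proof -
    have second: "derivI (derivI \<phi>) x = c x * \<phi> x - l * \<phi> x - 2 * s * derivI m x * derivI \<phi> x"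
      using ode[of x] that by simp
    show ?thesis
      unfolding g_def g'_def
      by (intro DERIV_cong[OF DERIV_mult[OF DERIV_chain2[OF DERIV_exp
            DERIV_cmult[OF C1_has_derivI[OF m that]]] C1_has_derivI[OF C that]]])
        (simp add: second algebra_simps)
  qed
  have g_ends: "g (-1) = 0" "g 1 = 0"
    using ends by (simp_all add: g_def)
  have "\<exists>z\<in>{-1<..<1}. g 1 - g (-1) = g' z * (1 - - 1)"
    by (rule mvt_simple[OF _ deriv[unfolded has_field_derivative_def]]) auto
  then obtain z where "-1 < z" "z < 1" and "g' z = 0"
    using g_ends by auto
  then have z: "z \<in> I" and l: "l = c z"
    using pos[of z] by (simp_all add: g'_def)
  have bound: "\<bar>g' x\<bar> \<le> 2 * B * exp (2 * s * m x)" if "x \<in> I" for x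
  proof -
    have "\<bar>\<phi> x\<bar> \<le> 1"
      using pos[OF that] eigenfunction_attains_one(1)[OF \<phi>] that by simp
    moreover have "\<bar>c x - l\<bar> \<le> 2 * B"
      using B[OF z] B[OF that] l by linarith
    ultimately have "\<bar>c x - l\<bar> * \<bar>\<phi> x\<bar> \<le> 2 * B * 1"
      by (intro mult_mono) auto
    then show ?thesis
      by (simp add: g'_def abs_mult)
  qed
  show ?thesis
    by (rule that[OF g_def g_ends deriv bound])
qed

section \<open>Convergence in the supremum norm\<close>

lemma sup_norm_tendsto_0I:
  assumes "\<And>\<epsilon>. \<epsilon> > 0 \<Longrightarrow> \<exists>S. \<forall>s\<ge>S. \<forall>x\<in>I. \<bar>f s x\<bar> \<le> \<epsilon>"
  shows "((\<lambda>s::real. sup_norm (f s)) \<longlongrightarrow> 0) at_top"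
proof (rule tendstoI)
  fix \<epsilon> :: real assume "\<epsilon> > 0"
  then obtain S where S: "\<And>s x. s \<ge> S \<Longrightarrow> x \<in> I \<Longrightarrow> \<bar>f s x\<bar> \<le> \<epsilon> / 2"
    using assms[of "\<epsilon> / 2"] by (meson half_gt_zero)
  have "dist (sup_norm (f s)) 0 < \<epsilon>" if s: "s \<ge> S" for s
  proof -
    have "bdd_above ((\<lambda>x. \<bar>f s x\<bar>) ` I)"
      by (rule bdd_aboveI2[OF S[OF s]])
    then have "\<bar>f s 0\<bar> \<le> sup_norm (f s)"
      unfolding sup_norm_def by (intro cSUP_upper) simp_all
    moreover have "sup_norm (f s) \<le> \<epsilon> / 2"
      unfolding sup_norm_def using S[OF s] by (intro cSUP_least) simp_all
    ultimately show ?thesis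
      using \<open>\<epsilon> > 0\<close> by (simp add: dist_real_def)
  qed
  then show "eventually (\<lambda>s. dist (sup_norm (f s)) 0 < \<epsilon>) at_top"
    by (auto simp: eventually_at_top_linorder)
qed

section \<open>The limit of large advection\<close>

lemma has_real_derivative_reflect:
  assumes "(f has_real_derivative D) (at (- x) within T)" and "uminus ` S \<subseteq> T"
  shows "((\<lambda>t. f (- t)) has_real_derivative - D) (at x within S)"
proof -
  have "(f \<circ> uminus has_real_derivative D * - 1) (at x within S)"
    by (rule DERIV_image_chain[OF DERIV_subset[OF assms]]) (auto intro!: derivative_eq_intros)
  then show ?thesis by (simp add: o_def)
qed

text \<open>The right half of the interval is reflected to \<open>{-1..-x0}\<close>, where the weight increases away
  from the endpoint at which the flux vanishes, just as on the left half.\<close>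

lemma Hm_strict_mono:
  assumes "Hm m"
  obtains x0 where "-1 < x0" "x0 < 1" "strict_mono_on {-1..x0} m"
    "strict_mono_on {-1..-x0} (\<lambda>x. m (- x))"
proof -
  obtain x0 where m: "C1 m" and max: "max_point m x0"
    and pos: "\<And>x. x \<in> {-1..<x0} \<Longrightarrow> derivI m x \<ge> 0"
    and neg: "\<And>x. x \<in> {x0<..1} \<Longrightarrow> derivI m x \<le> 0"
    and fin: "finite {x \<in> {-1<..<1}. derivI m x = 0}"
    using assms unfolding Hm_def by blast
  have x0: "-1 < x0" "x0 < 1" using max by (auto simp: max_point_def)
  have "strict_mono_on {-1..x0} m"
  proof (rule strict_mono_on_finite_critical[of _ _ _ "derivI m"])
    show "(m has_real_derivative derivI m x) (at x within {-1..x0})" if "x \<in> {-1..x0}" for x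
      using that x0 by (intro DERIV_subset[OF C1_has_derivI[OF m]]) auto
    show "finite {x \<in> {-1<..<x0}. derivI m x = 0}"
      using x0 by (intro finite_subset[OF _ fin]) auto
  qed (use pos in simp)
  moreover have "strict_mono_on {-1..-x0} (\<lambda>x. m (- x))"
  proof (rule strict_mono_on_finite_critical[of _ _ _ "\<lambda>x. - derivI m (- x)"])
    show "((\<lambda>x. m (- x)) has_real_derivative - derivI m (- x)) (at x within {-1..-x0})"
      if "x \<in> {-1..-x0}" for x
      using that x0 by (intro has_real_derivative_reflect[OF C1_has_derivI[OF m]]) auto
    have "{x \<in> {-1<..<-x0}. - derivI m (- x) = 0} \<subseteq> uminus ` {x \<in> {-1<..<1}. derivI m x = 0}"
    proof
      fix x assume "x \<in> {x \<in> {-1<..<-x0}. - derivI m (- x) = 0}"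
      then have "- x \<in> {x \<in> {-1<..<1}. derivI m x = 0}" using x0 by auto
      then have "- (- x) \<in> uminus ` {x \<in> {-1<..<1}. derivI m x = 0}" by (rule imageI)
      then show "x \<in> uminus ` {x \<in> {-1<..<1}. derivI m x = 0}" by simp
    qed
    then show "finite {x \<in> {-1<..<-x0}. - derivI m (- x) = 0}"
      using fin by (blast intro: finite_subset)
  qed (use neg in simp)
  ultimately show ?thesis using that x0 by blast
qed

theorem theorem1p1:
  fixes m c :: "real \<Rightarrow> real" and \<phi> :: "real \<Rightarrow> real \<Rightarrow> real"
  assumes "continuous_on I c"
    and "Hm m"
    and "\<And>s. normalized_principal_eigenfunction m c s (\<phi> s)"
  shows "((\<lambda>s. sup_norm (derivI (\<phi> s))) \<longlongrightarrow> 0) at_top \<and>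
    ((\<lambda>s. sup_norm (\<lambda>x. \<phi> s x - 1)) \<longlongrightarrow> 0) at_top"
proof -
  obtain x0 where x0: "-1 < x0" "x0 < 1" and incr: "strict_mono_on {-1..x0} m"
    and decr: "strict_mono_on {-1..-x0} (\<lambda>x. m (- x))"
    using Hm_strict_mono[OF assms(2)] .
  have m: "C1 m" using assms(2) by (simp add: Hm_def)
  have cont: "continuous_on I m"
    by (rule DERIV_continuous_on[OF C1_has_derivI[OF m]])
  have C1\<phi>: "C1 (\<phi> s)" for s
    using assms(3)[of s]
    by (simp add: normalized_principal_eigenfunction_def positive_solution_def C2_def)
  have "bounded (c ` I)"
    by (intro compact_imp_bounded compact_continuous_image assms(1)) auto
  then obtain B where "B > 0" and B: "\<And>x. x \<in> I \<Longrightarrow> \<bar>c x\<bar> \<le> B"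
    by (auto simp: bounded_pos)
  have deriv_small: "\<exists>S. \<forall>s\<ge>S. \<forall>x\<in>I. \<bar>derivI (\<phi> s) x\<bar> \<le> \<epsilon>" if "\<epsilon> > 0" for \<epsilon>
  proof -
    have cl: "continuous_on {-1..x0} m"
      using x0 by (intro continuous_on_subset[OF cont]) auto
    have cr: "continuous_on {-1..-x0} (\<lambda>x. m (- x))"
      using x0 by (intro continuous_on_compose2[OF cont] continuous_intros) auto
    obtain S1 where S1: "\<And>s g g' x. s \<ge> S1 \<Longrightarrow> g (-1) = 0 \<Longrightarrow>
        (\<And>t. t \<in> {-1..x0} \<Longrightarrow> (g has_real_derivative g' t) (at t within {-1..x0})) \<Longrightarrow>
        (\<And>t. t \<in> {-1..x0} \<Longrightarrow> \<bar>g' t\<bar> \<le> 2 * B * exp (2 * s * m t)) \<Longrightarrow>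
        x \<in> {-1..x0} \<Longrightarrow> \<bar>g x\<bar> \<le> \<epsilon> * exp (2 * s * m x)"
      by (rule flux_small[OF cl incr, of "2 * B" \<epsilon>]) (use x0 \<open>B > 0\<close> \<open>\<epsilon> > 0\<close> in auto)
    obtain S2 where S2: "\<And>s g g' x. s \<ge> S2 \<Longrightarrow> g (-1) = 0 \<Longrightarrow>
        (\<And>t. t \<in> {-1..-x0} \<Longrightarrow> (g has_real_derivative g' t) (at t within {-1..-x0})) \<Longrightarrow>
        (\<And>t. t \<in> {-1..-x0} \<Longrightarrow> \<bar>g' t\<bar> \<le> 2 * B * exp (2 * s * m (- t))) \<Longrightarrow>
        x \<in> {-1..-x0} \<Longrightarrow> \<bar>g x\<bar> \<le> \<epsilon> * exp (2 * s * m (- x))"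
      by (rule flux_small[OF cr decr, of "2 * B" \<epsilon>]) (use x0 \<open>B > 0\<close> \<open>\<epsilon> > 0\<close> in auto)
    show ?thesis
    proof (intro exI[of _ "max S1 S2"] allI impI ballI)
      fix s x assume s: "s \<ge> max S1 S2" and x: "x \<in> I"
      obtain g g' where g_def: "\<And>x. g x = exp (2 * s * m x) * derivI (\<phi> s) x"
        and g0: "g (-1) = 0" "g 1 = 0"
        and g: "\<And>x. x \<in> I \<Longrightarrow> (g has_real_derivative g' x) (at x within I)"
        and gb: "\<And>x. x \<in> I \<Longrightarrow> \<bar>g' x\<bar> \<le> 2 * B * exp (2 * s * m x)"
        using normalized_flux_bound[OF m assms(3)[of s] B] by blast
      have "\<bar>g x\<bar> \<le> \<epsilon> * exp (2 * s * m x)"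
      proof (cases "x \<le> x0")
        case True
        show ?thesis
        proof (rule S1[of s g g'])
          show "(g has_real_derivative g' t) (at t within {-1..x0})" if "t \<in> {-1..x0}" for t
            using that x0 by (intro DERIV_subset[OF g]) auto
          show "\<bar>g' t\<bar> \<le> 2 * B * exp (2 * s * m t)" if "t \<in> {-1..x0}" for t
            using that x0 by (intro gb) simp
        qed (use True s x g0 in simp_all)
      next
        case False
        have "\<bar>g (- (- x))\<bar> \<le> \<epsilon> * exp (2 * s * m (- (- x)))"
        proof (rule S2[of s "\<lambda>t. g (- t)" "\<lambda>t. - g' (- t)" "- x"])
          show "((\<lambda>t. g (- t)) has_real_derivative - g' (- t)) (at t within {-1..-x0})"
            if "t \<in> {-1..-x0}" for t
            using that x0 by (intro has_real_derivative_reflect[OF g]) auto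
          show "\<bar>- g' (- t)\<bar> \<le> 2 * B * exp (2 * s * m (- t))" if "t \<in> {-1..-x0}" for t
            using gb[of "- t"] that x0 by simp
        qed (use False s x g0 in simp_all)
        then show ?thesis by simp
      qed
      then show "\<bar>derivI (\<phi> s) x\<bar> \<le> \<epsilon>"
        by (simp add: g_def abs_mult mult.commute)
    qed
  qed
  have "\<exists>S. \<forall>s\<ge>S. \<forall>x\<in>I. \<bar>\<phi> s x - 1\<bar> \<le> \<epsilon>" if "\<epsilon> > 0" for \<epsilon>
  proof -
    obtain S where S: "\<And>s x. s \<ge> S \<Longrightarrow> x \<in> I \<Longrightarrow> \<bar>derivI (\<phi> s) x\<bar> \<le> \<epsilon> / 2"
      using deriv_small[of "\<epsilon> / 2"] \<open>\<epsilon> > 0\<close> by (meson half_gt_zero)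
    show ?thesis
    proof (intro exI[of _ S] allI impI ballI)
      fix s x assume s: "s \<ge> S" and x: "x \<in> I"
      obtain z where z: "z \<in> I" "\<phi> s z = 1"
        using eigenfunction_attains_one(2)[OF assms(3)] by blast
      have "norm (\<phi> s x - \<phi> s z) \<le> \<epsilon> / 2 * norm (x - z)"
        using S[OF s] x z
        by (intro field_differentiable_bound[OF _ C1_has_derivI[OF C1\<phi>]]) simp_all
      also have "\<dots> \<le> \<epsilon> / 2 * 2"
        using x z \<open>\<epsilon> > 0\<close> by (intro mult_left_mono) auto
      finally show "\<bar>\<phi> s x - 1\<bar> \<le> \<epsilon>"
        using z by simp
    qed
  qed
  then show ?thesis
    using deriv_small by (intro conjI sup_norm_tendsto_0I) auto
qed

end
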